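(* Fix a tree partition of $\omega$. If $k\ge\ell\ge2$ then $\mathcal G_k\le_{KB}\mathcal G_\ell$, with an injective witness: there is an injection $f:\omega\to\omega$ such that $f^{-1}[A]\in\mathcal G_\ell$ for every $A\in\mathcal G_k$.
   Context: A tree partition of $\omega$ is a family $\langle A_s:s\in\omega^{<\omega}\rangle$ of infinite subsets of $\omega$ such that $A_\varnothing=\omega$, for each $s$ the family $\{A_{s^\frown n}:n\in\omega\}$ is a partition of $A_s$, and any two distinct points of $\omega$ lie in different cells $A_s\neq A_t$ with $|s|=|t|=n$ for some $n$. For $x\in\omega$, $b_x\in\omega^\omega$ is the unique branch with $x\in A_{b_x\upharpoonright n}$ for all $n$; for $x\ne y$, $\Delta(x,y)=\min\{n:b_x(n)\ne b_y(n)\}$. For $k\ge2$, $c_k(\{x,y\})=\Delta(x,y)\bmod k$; a set $H\subseteq\omega$ is $c_k$-homogeneous if $c_k$ is constant on the pairs of elements of $H$; $\mathcal G_k$ is the ideal on $\omega$ generated by the $c_k$-homogeneous sets (and the finite sets). $\mathcal I\le_{KB}\mathcal J$ (for ideals on $\omega$) means there is a finite-to-one $f:\omega\to\omega$ with $f^{-1}[A]\in\mathcal J$ for every $A\in\mathcal I$. *)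

theory Defs
  imports "HOL-Library.Disjoint_Sets" "HOL.Hull"
begin

text \<open>
  Nodes of the tree \<open>\<omega>\<^sup><\<^sup>\<omega>\<close> are lists of naturals; the one-step extension of a node \<open>s\<close> by \<open>n\<close>
  is \<open>s @ [n]\<close>, and the restriction of a branch \<open>b\<close> to \<open>n\<close> is \<open>map b [0..<n]\<close>.
\<close>

definition tree_partition :: "(nat list \<Rightarrow> nat set) \<Rightarrow> bool" where
  "tree_partition A \<longleftrightarrow>
     (\<forall>s. infinite (A s)) \<and>
     A [] = UNIV \<and>
     (\<forall>s. disjoint_family (\<lambda>n. A (s @ [n])) \<and> (\<Union>n. A (s @ [n])) = A s) \<and>
     (\<forall>x y. x \<noteq> y \<longrightarrow>
        (\<exists>s t. length s = length t \<and> A s \<noteq> A t \<and> x \<in> A s \<and> y \<in> A t))"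

definition branch :: "(nat list \<Rightarrow> nat set) \<Rightarrow> nat \<Rightarrow> nat \<Rightarrow> nat" where
  "branch A x = (THE b. \<forall>n. x \<in> A (map b [0..<n]))"

text \<open>Only meaningful for \<open>x \<noteq> y\<close>.\<close>

definition Delta :: "(nat list \<Rightarrow> nat set) \<Rightarrow> nat \<Rightarrow> nat \<Rightarrow> nat" where
  "Delta A x y = (LEAST n. branch A x n \<noteq> branch A y n)"

text \<open>The colouring of unordered pairs, as a symmetric function of two arguments.\<close>

definition coloring :: "(nat list \<Rightarrow> nat set) \<Rightarrow> nat \<Rightarrow> nat \<Rightarrow> nat \<Rightarrow> nat" where
  "coloring A k x y = Delta A x y mod k"

definition homogeneous :: "(nat list \<Rightarrow> nat set) \<Rightarrow> nat \<Rightarrow> nat set \<Rightarrow> bool" where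
  "homogeneous A k H \<longleftrightarrow> (\<exists>i. \<forall>x\<in>H. \<forall>y\<in>H. x \<noteq> y \<longrightarrow> coloring A k x y = i)"

text \<open>
  Properness is not part of this notion, so that the ideal generated by a family (its hull)
  always exists.
\<close>

definition set_ideal :: "nat set set \<Rightarrow> bool" where
  "set_ideal I \<longleftrightarrow>
     {} \<in> I \<and>
     (\<forall>X\<in>I. \<forall>Y. Y \<subseteq> X \<longrightarrow> Y \<in> I) \<and>
     (\<forall>X\<in>I. \<forall>Y\<in>I. X \<union> Y \<in> I)"

definition G_ideal :: "(nat list \<Rightarrow> nat set) \<Rightarrow> nat \<Rightarrow> nat set set" where
  "G_ideal A k = set_ideal hull ({H. homogeneous A k H} \<union> {F. finite F})"

definition KB_le :: "nat set set \<Rightarrow> nat set set \<Rightarrow> bool" where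
  "KB_le I J \<longleftrightarrow>
     (\<exists>f :: nat \<Rightarrow> nat. (\<forall>n. finite (f -` {n})) \<and> (\<forall>X\<in>I. f -` X \<in> J))"

end

theory Submission
  imports Defs
begin

text \<open>
  It suffices to find an injection \<open>f\<close> such that \<open>\<Delta>(f x, f y) = \<phi> (\<Delta>(x, y))\<close> for all
  \<open>x \<noteq> y\<close>, where \<open>\<phi> n = k * (n div l) + n mod l\<close>. Because \<open>l \<le> k\<close>, the residue of \<open>\<phi> n\<close>
  modulo \<open>k\<close> is the residue of \<open>n\<close> modulo \<open>l\<close>, so \<open>c\<^sub>k (f x, f y) = c\<^sub>l (x, y)\<close>: the preimage of
  a \<open>c\<^sub>k\<close>-homogeneous set is \<open>c\<^sub>l\<close>-homogeneous. Preimages of finite sets are finite by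
  injectivity. These are the generators of \<open>\<G>\<^sub>k\<close>, and since the sets whose preimage lies in
  \<open>\<G>\<^sub>l\<close> form an ideal, the whole of \<open>\<G>\<^sub>k\<close> is mapped back into \<open>\<G>\<^sub>l\<close>.

  Spreading out the branch of \<open>x\<close> along \<open>\<phi>\<close> would give the right distances, but the resulting
  branch need not belong to a point of \<open>\<omega>\<close>: only countably many branches do. Instead \<open>f\<close> is built
  point by point, using only the fact that \<open>\<phi>\<close> is strictly increasing. Every cell is nonempty and
  every node has infinitely many children, so an isometry (up to \<open>\<phi>\<close>) of a finite set can always be
  extended by one more point (lemma \<open>extend_embedding\<close>): follow the image of a nearest neighbour up
  to the prescribed level, and there leave into a child avoided by all earlier images.
\<close>

section \<open>Branches of a tree partition\<close>

lemma cell_snoc_subset: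
  assumes "tree_partition A"
  shows "A (s @ [n]) \<subseteq> A s"
  using assms unfolding tree_partition_def by blast

lemma cell_unique:
  assumes T: "tree_partition A"
  shows "length s = length t \<Longrightarrow> x \<in> A s \<Longrightarrow> x \<in> A t \<Longrightarrow> s = t"
proof (induction s arbitrary: t rule: rev_induct)
  case Nil
  then show ?case by simp
next
  case (snoc m s)
  then obtain t' m' where t: "t = t' @ [m']"
    by (cases t rule: rev_cases) auto
  then have "s = t'"
    using snoc cell_snoc_subset[OF T] by (metis length_append_singleton nat.inject subsetD)
  moreover have "disjoint_family (\<lambda>n. A (s @ [n]))"
    using T unfolding tree_partition_def by blast
  ultimately have "m = m'"
    using snoc.prems t unfolding disjoint_family_on_def by blast
  with t \<open>s = t'\<close> show ?case by simp
qed

lemma branch_exists: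
  assumes T: "tree_partition A"
  shows "\<exists>b. \<forall>n. x \<in> A (map b [0..<n])"
proof -
  \<comment> \<open>The implication makes a digit exist after any prefix, even one whose cell misses \<open>x\<close>;
    its premise is discharged by induction along the sequence obtained.\<close>
  define P where "P b n r \<longleftrightarrow> (x \<in> A (map b [0..<n]) \<longrightarrow> x \<in> A (map b [0..<n] @ [r]))"
    for b :: "nat \<Rightarrow> nat" and n r
  have "\<exists>b. \<forall>n. P b n (b n)"
  proof (rule dependent_wellorder_choice)
    fix r n and b c :: "nat \<Rightarrow> nat"
    assume "\<And>m. m < n \<Longrightarrow> b m = c m"
    then have "map b [0..<n] = map c [0..<n]" by simp
    then show "P b n r = P c n r" by (simp only: P_def)
  next
    fix n b
    have "(\<Union>r. A (map b [0..<n] @ [r])) = A (map b [0..<n])"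
      using T unfolding tree_partition_def by blast
    then show "\<exists>r. P b n r" unfolding P_def by blast
  qed
  then obtain b where b: "\<And>n. P b n (b n)" by blast
  have "x \<in> A (map b [0..<n])" for n
  proof (induction n)
    case 0
    show ?case using T by (simp add: tree_partition_def)
  next
    case (Suc n)
    then show ?case using b[of n] by (simp add: P_def)
  qed
  then show ?thesis by blast
qed

lemma mem_branch:
  assumes T: "tree_partition A"
  shows "x \<in> A (map (branch A x) [0..<n])"
proof -
  have "\<exists>!b. \<forall>n. x \<in> A (map b [0..<n])"
  proof (rule ex_ex1I[OF branch_exists[OF T]])
    fix b c assume b: "\<forall>n. x \<in> A (map b [0..<n])" and c: "\<forall>n. x \<in> A (map c [0..<n])"
    show "b = c"
    proof
      fix n
      have "map b [0..<Suc n] = map c [0..<Suc n]"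
        by (rule cell_unique[OF T]) (use b c in \<open>auto simp del: upt_Suc\<close>)
      then show "b n = c n" by simp
    qed
  qed
  from theI'[OF this] show ?thesis unfolding branch_def by blast
qed

lemma mem_cell_iff:
  assumes "tree_partition A"
  shows "x \<in> A s \<longleftrightarrow> s = map (branch A x) [0..<length s]"
proof
  assume "x \<in> A s"
  then show "s = map (branch A x) [0..<length s]"
    by (intro cell_unique[OF assms _ _ mem_branch[OF assms]]) simp_all
next
  assume "s = map (branch A x) [0..<length s]"
  then show "x \<in> A s"
    using mem_branch[OF assms, of x "length s"] by simp
qed

lemma branch_inj:
  assumes T: "tree_partition A" and "x \<noteq> y"
  shows "branch A x \<noteq> branch A y"
proof
  assume eq: "branch A x = branch A y"
  obtain s t where "length s = length t" "A s \<noteq> A t" "x \<in> A s" "y \<in> A t"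
    using assms unfolding tree_partition_def by blast
  with eq have "s = t" using mem_cell_iff[OF T, of x s] mem_cell_iff[OF T, of y t] by simp
  with \<open>A s \<noteq> A t\<close> show False by simp
qed

section \<open>The splitting level of two points\<close>

lemma branch_Delta_neq:
  assumes "tree_partition A" "x \<noteq> y"
  shows "branch A x (Delta A x y) \<noteq> branch A y (Delta A x y)"
proof -
  have "\<exists>n. branch A x n \<noteq> branch A y n"
    using branch_inj[OF assms] by (simp add: fun_eq_iff)
  then show ?thesis unfolding Delta_def by (rule LeastI_ex)
qed

lemma branch_eq_below_Delta:
  "i < Delta A x y \<Longrightarrow> branch A x i = branch A y i"
  unfolding Delta_def by (drule not_less_Least) simp

lemma Delta_eqI:
  assumes "\<And>i. i < n \<Longrightarrow> branch A x i = branch A y i" "branch A x n \<noteq> branch A y n"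
  shows "Delta A x y = n"
  unfolding Delta_def
proof (rule Least_equality)
  show "n \<le> m" if "branch A x m \<noteq> branch A y m" for m
    using assms(1)[of m] that by (cases "m < n") simp_all
qed (rule assms(2))

lemma Delta_commute: "Delta A x y = Delta A y x"
  unfolding Delta_def by (rule arg_cong[where f = Least]) auto

section \<open>Embeddings that reindex the splitting levels\<close>

text \<open>
  Let \<open>u0\<close> be a point of \<open>F\<close> that splits from \<open>x\<close> as late as possible, at level \<open>d\<close>. The new point
  is taken to split from \<open>f u0\<close> exactly at level \<open>\<phi> d\<close>. A point \<open>u\<close> that leaves \<open>x\<close> before level
  \<open>d\<close> leaves \<open>u0\<close> at the same level, so its distance comes out right by itself; for
  the points that leave \<open>x\<close> exactly at level \<open>d\<close>, it is the fresh child that gives the distance.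
\<close>

lemma extend_embedding:
  assumes T: "tree_partition A" and mono: "strict_mono \<phi>" and "finite F" and "x \<notin> F"
    and f: "\<And>u v. u \<in> F \<Longrightarrow> v \<in> F \<Longrightarrow> u \<noteq> v \<Longrightarrow>
      f u \<noteq> f v \<and> Delta A (f u) (f v) = \<phi> (Delta A u v)"
  shows "\<exists>y. \<forall>u\<in>F. y \<noteq> f u \<and> Delta A y (f u) = \<phi> (Delta A x u)"
proof (cases "F = {}")
  case True
  then show ?thesis by simp
next
  case False
  define d where "d = Max (Delta A x ` F)"
  have "d \<in> Delta A x ` F"
    unfolding d_def using False \<open>finite F\<close> by simp
  then obtain u0 where u0: "u0 \<in> F" "Delta A x u0 = d" by blast
  have le_d: "Delta A x u \<le> d" if "u \<in> F" for u
    unfolding d_def using that \<open>finite F\<close> by simp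
  obtain m where m: "m \<notin> (\<lambda>u. branch A (f u) (\<phi> d)) ` F"
    using \<open>finite F\<close> by (meson ex_new_if_finite finite_imageI infinite_UNIV_nat)
  let ?s = "map (branch A (f u0)) [0..<\<phi> d] @ [m]"
  have "infinite (A ?s)" using T unfolding tree_partition_def by blast
  then obtain y where "y \<in> A ?s" by fastforce
  then have eq: "?s = map (branch A y) [0..<Suc (\<phi> d)]"
    using mem_cell_iff[OF T, of y ?s] by simp
  then have y_below: "branch A y i = branch A (f u0) i" if "i < \<phi> d" for i
    using that by simp
  from eq have y_at: "branch A y (\<phi> d) = m" by simp
  have "branch A y i = branch A (f u) i" if u: "u \<in> F" and i: "i < \<phi> (Delta A x u)" for u i
  proof -
    have "i < \<phi> d"
      using i le_d[OF u] strict_mono_less_eq[OF mono] by (meson less_le_trans)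
    moreover have "branch A (f u0) i = branch A (f u) i"
    proof (cases "u = u0")
      case False
      have "Delta A x u \<le> Delta A u0 u"
      proof (rule ccontr)
        assume "\<not> Delta A x u \<le> Delta A u0 u"
        then have "branch A u0 (Delta A u0 u) = branch A u (Delta A u0 u)"
          using branch_eq_below_Delta u0(2) le_d[OF u]
          by (metis less_le_trans not_le)
        then show False using branch_Delta_neq[OF T] False by metis
      qed
      then have "\<phi> (Delta A x u) \<le> Delta A (f u0) (f u)"
        using f[OF u0(1) u] False strict_mono_less_eq[OF mono] by simp
      then show ?thesis using i by (intro branch_eq_below_Delta) simp
    qed simp
    ultimately show ?thesis using y_below by simp
  qed
  moreover have "branch A y (\<phi> (Delta A x u)) \<noteq> branch A (f u) (\<phi> (Delta A x u))"
    if u: "u \<in> F" for u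
  proof (cases "Delta A x u = d")
    case True
    then show ?thesis using m u y_at by auto
  next
    case False
    with le_d[OF u] have lt: "Delta A x u < d" by simp
    have "u \<noteq> u0" "x \<noteq> u" using False u0(2) u \<open>x \<notin> F\<close> by auto
    have "Delta A u0 u = Delta A x u"
    proof (rule Delta_eqI)
      show "branch A u0 i = branch A u i" if "i < Delta A x u" for i
        using branch_eq_below_Delta that u0(2) lt by (metis less_trans)
      show "branch A u0 (Delta A x u) \<noteq> branch A u (Delta A x u)"
        using branch_eq_below_Delta u0(2) lt branch_Delta_neq[OF T \<open>x \<noteq> u\<close>] by metis
    qed
    then have "branch A (f u0) (\<phi> (Delta A x u)) \<noteq> branch A (f u) (\<phi> (Delta A x u))"
      using f[OF u0(1) u] \<open>u \<noteq> u0\<close> branch_Delta_neq[OF T] by metis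
    then show ?thesis using y_below lt strict_mono_less[OF mono] by simp
  qed
  ultimately have "\<forall>u\<in>F. y \<noteq> f u \<and> Delta A y (f u) = \<phi> (Delta A x u)"
    by (metis Delta_eqI)
  then show ?thesis by blast
qed

lemma embedding_exists:
  assumes T: "tree_partition A" and mono: "strict_mono \<phi>"
  shows "\<exists>f. inj f \<and> (\<forall>x y. x \<noteq> y \<longrightarrow> Delta A (f x) (f y) = \<phi> (Delta A x y))"
proof -
  define P where "P f x y \<longleftrightarrow> (\<forall>u<x. y \<noteq> f u \<and> Delta A y (f u) = \<phi> (Delta A x u))"
    for f :: "nat \<Rightarrow> nat" and x y
  have "\<exists>f. \<forall>x. P f x (f x)"
  proof (rule dependent_wellorder_choice)
    show "P f x r = P g x r" if "\<And>y. y < x \<Longrightarrow> f y = g y" for r f g x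
      using that by (simp add: P_def)
  next
    fix x f
    assume IH: "\<And>y. y < x \<Longrightarrow> P f y (f y)"
    have "\<exists>y. \<forall>u\<in>{..<x}. y \<noteq> f u \<and> Delta A y (f u) = \<phi> (Delta A x u)"
    proof (rule extend_embedding[OF T mono])
      fix u v assume uv: "u \<in> {..<x}" "v \<in> {..<x}" "u \<noteq> v"
      then consider "u < v" | "v < u" by linarith
      then show "f u \<noteq> f v \<and> Delta A (f u) (f v) = \<phi> (Delta A u v)"
        using IH uv unfolding P_def by cases (metis Delta_commute lessThan_iff)+
    qed auto
    then show "\<exists>r. P f x r" by (auto simp: P_def)
  qed
  then obtain f where f: "\<And>x. P f x (f x)" by blast
  have f': "f x \<noteq> f y \<and> Delta A (f x) (f y) = \<phi> (Delta A x y)" if "x \<noteq> y" for x y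
  proof -
    from that consider "x < y" | "y < x" by linarith
    then show ?thesis using f unfolding P_def by cases (metis Delta_commute)+
  qed
  then have "inj f" by (auto intro: injI)
  with f' show ?thesis by blast
qed

section \<open>Reduction to generators\<close>

lemma set_ideal_subset:
  assumes "set_ideal I" "X \<in> I" "Y \<subseteq> X"
  shows "Y \<in> I"
proof -
  have "\<forall>X\<in>I. \<forall>Y. Y \<subseteq> X \<longrightarrow> Y \<in> I"
    using assms(1) unfolding set_ideal_def by (elim conjE)
  from this[rule_format, OF assms(2,3)] show ?thesis .
qed

lemma set_ideal_Un:
  assumes "set_ideal I" "X \<in> I" "Y \<in> I"
  shows "X \<union> Y \<in> I"
  using assms unfolding set_ideal_def by simp

lemma set_ideal_G_ideal: "set_ideal (G_ideal A k)"
proof -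
  have "set_ideal (\<Inter>T)" if "Ball T set_ideal" for T
    unfolding set_ideal_def
  proof (intro conjI ballI allI impI)
    show "{} \<in> \<Inter>T"
      using that by (auto simp: set_ideal_def)
    show "Y \<in> \<Inter>T" if "X \<in> \<Inter>T" "Y \<subseteq> X" for X Y
      using that \<open>Ball T set_ideal\<close> by (auto intro: set_ideal_subset)
    show "X \<union> Y \<in> \<Inter>T" if "X \<in> \<Inter>T" "Y \<in> \<Inter>T" for X Y
      using that \<open>Ball T set_ideal\<close> by (auto intro: set_ideal_Un)
  qed
  then show ?thesis unfolding G_ideal_def by (rule hull_in)
qed

lemma homogeneous_in_G_ideal: "homogeneous A k H \<Longrightarrow> H \<in> G_ideal A k"
  and finite_in_G_ideal: "finite F \<Longrightarrow> F \<in> G_ideal A k"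
  unfolding G_ideal_def by (auto intro: hull_inc)

text \<open>
  The sets with preimage in \<open>J\<close> form an ideal, the pushforward of \<open>J\<close>; hence it contains
  \<open>\<G>\<^sub>k\<close> as soon as it contains the generators.
\<close>

lemma vimage_in_ideal:
  assumes J: "set_ideal J" and f: "\<And>n. finite (f -` {n})" and fin: "\<And>F. finite F \<Longrightarrow> F \<in> J"
    and hom: "\<And>H. homogeneous A k H \<Longrightarrow> f -` H \<in> J"
    and X: "X \<in> G_ideal A k"
  shows "f -` X \<in> J"
proof -
  have "finite (f -` F)" if "finite F" for F
    using that f by (subst vimage_eq_UN) blast
  then have "{H. homogeneous A k H} \<union> {F. finite F} \<subseteq> {X. f -` X \<in> J}"
    using hom fin by blast
  moreover have "set_ideal {X. f -` X \<in> J}"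
  proof -
    have "f -` Y \<in> J" if "f -` X \<in> J" "Y \<subseteq> X" for X Y
      using set_ideal_subset[OF J that(1) vimage_mono[OF that(2)]] .
    moreover have "f -` (X \<union> Y) \<in> J" if "f -` X \<in> J" "f -` Y \<in> J" for X Y
      unfolding vimage_Un using J that by (rule set_ideal_Un)
    ultimately show ?thesis
      using fin[of "{}"] unfolding set_ideal_def by simp
  qed
  ultimately have "G_ideal A k \<subseteq> {X. f -` X \<in> J}"
    unfolding G_ideal_def by (rule hull_minimal)
  with X show ?thesis by blast
qed

section \<open>The comparison of the ideals\<close>

text \<open>
  The map sends the \<open>q\<close>-th block of length \<open>l\<close> to the start of the \<open>q\<close>-th block of length \<open>k\<close>,
  where it fits because \<open>l \<le> k\<close>; this is what keeps the blocks in order.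
\<close>

lemma strict_mono_block_shift:
  fixes k l :: nat
  assumes "l \<le> k" "0 < l"
  shows "strict_mono (\<lambda>n. k * (n div l) + n mod l)"
proof (rule strict_monoI)
  fix m n :: nat assume "m < n"
  then consider "m div l = n div l" | "m div l < n div l"
    using div_le_mono[of m n l] by linarith
  then show "k * (m div l) + m mod l < k * (n div l) + n mod l"
  proof cases
    case 1
    then have "m mod l < n mod l"
      using \<open>m < n\<close> by (metis mult_div_mod_eq nat_add_left_cancel_less)
    with 1 show ?thesis by simp
  next
    case 2
    have "m mod l < k" using assms by (meson less_le_trans mod_less_divisor)
    then have "k * (m div l) + m mod l < k * Suc (m div l)" by simp
    also have "\<dots> \<le> k * (n div l)" using 2 by (intro mult_le_mono2) simp
    finally show ?thesis by simp
  qed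
qed

theorem theorem6p2:
  fixes A :: "nat list \<Rightarrow> nat set" and k l :: nat
  assumes "tree_partition A"
    and "k \<ge> l" and "l \<ge> 2"
  shows "KB_le (G_ideal A k) (G_ideal A l) \<and>
    (\<exists>f :: nat \<Rightarrow> nat. inj f \<and> (\<forall>X\<in>G_ideal A k. f -` X \<in> G_ideal A l))"
proof -
  let ?\<phi> = "\<lambda>n. k * (n div l) + n mod l"
  have "strict_mono ?\<phi>" using assms by (intro strict_mono_block_shift) auto
  from embedding_exists[OF assms(1) this]
  obtain f where "inj f" and f: "\<And>x y. x \<noteq> y \<Longrightarrow> Delta A (f x) (f y) = ?\<phi> (Delta A x y)"
    by blast
  have "n mod l < k" for n
    using assms by (meson less_le_trans mod_less_divisor zero_less_numeral)
  then have color: "coloring A l x y = coloring A k (f x) (f y)" if "x \<noteq> y" for x y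
    using f[OF that] by (simp add: coloring_def)
  have fin: "finite (f -` {n})" for n
    using \<open>inj f\<close> by (simp add: finite_vimageI)
  have "f -` X \<in> G_ideal A l" if "X \<in> G_ideal A k" for X
  proof (rule vimage_in_ideal[OF set_ideal_G_ideal fin finite_in_G_ideal _ that])
    fix H assume "homogeneous A k H"
    then have "homogeneous A l (f -` H)"
      using color \<open>inj f\<close> unfolding homogeneous_def by (metis injD vimageE)
    then show "f -` H \<in> G_ideal A l" by (rule homogeneous_in_G_ideal)
  qed
  with fin \<open>inj f\<close> show ?thesis unfolding KB_le_def by blast
qed

end
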